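(* Let $S,T$ be cancellative right amenable semigroups, $A,B$ abelian groups, and $S\overset{\alpha}{\curvearrowright}A$, $T\overset{\beta}{\curvearrowright}B$ left actions by group endomorphisms. If $\alpha$ and $\beta$ are weakly conjugated, then $h_{alg}(\alpha)=h_{alg}(\beta)$.
   Context: A semigroup $S$ is cancellative if all left and right multiplications are injective. $S$ is right amenable if there is a finitely additive $\mu:\mathcal P(S)\to[0,1]$ with $\mu(S)=1$ and $\mu(R_s^{-1}(F))=\mu(F)$ for all $s\in S$, $F\subseteq S$, where $R_s(x)=xs$. A right Følner net of $S$ is a net $(F_i)_{i\in I}$ of non-empty finite subsets of $S$ with $\lim_{i\in I}|F_is\setminus F_i|/|F_i|=0$ for every $s\in S$ (such nets exist when $S$ is cancellative right amenable). A left action $S\overset{\alpha}{\curvearrowright}A$ assigns to each $s\in S$ an endomorphism $\alpha(s)$ of $A$ with $\alpha(st)=\alpha(s)\circ\alpha(t)$ (and $\alpha(1)=\mathrm{id}_A$ if $S$ is a monoid). The actions $\alpha$ and $\beta$ are weakly conjugated if there exist a semigroup isomorphism $\eta:S\to T$ and a group isomorphism $\xi:A\to B$ such that $\xi\circ\alpha(s)=\beta(\eta(s))\circ\xi$ for every $s\in S$. For non-empty finite $X\subseteq A$ and non-empty finite $F\subseteq S$ put $T_F(\alpha,X)=\sum_{s\in F}\alpha(s)(X)$ (sum of subsets). Set $H_{alg}(\alpha,X)=\lim_{i\in I}\frac{\log|T_{F_i}(\alpha,X)|}{|F_i|}$ for any right Følner net $(F_i)_{i\in I}$ of $S$; the limit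 is known to exist, to be finite, and not to depend on the net. Define $h_{alg}(\alpha)=\sup\{H_{alg}(\alpha,X):X\subseteq A\text{ non-empty finite}\}\in[0,\infty]$. *)

theory Defs
  imports
    Complex_Main
    "HOL-Library.Extended_Real"
    "HOL-Library.Set_Algebras"
begin

section \<open>Semigroups and actions\<close>

definition cancellative :: "'s::semigroup_mult itself \<Rightarrow> bool" where
  "cancellative _ \<longleftrightarrow> (\<forall>s::'s. inj (\<lambda>x. s * x)) \<and> (\<forall>s::'s. inj (\<lambda>x. x * s))"

definition right_amenable :: "'s::semigroup_mult itself \<Rightarrow> bool" where
  "right_amenable _ \<longleftrightarrow> (\<exists>\<mu> :: 's set \<Rightarrow> real.
     (\<forall>F. 0 \<le> \<mu> F \<and> \<mu> F \<le> 1) \<and>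
     \<mu> UNIV = 1 \<and>
     (\<forall>E F. E \<inter> F = {} \<longrightarrow> \<mu> (E \<union> F) = \<mu> E + \<mu> F) \<and>
     (\<forall>s F. \<mu> ((\<lambda>x. x * s) -` F) = \<mu> F))"

text \<open>The last clause says that the identity acts trivially whenever the semigroup is a monoid.\<close>

definition left_action :: "('s::semigroup_mult \<Rightarrow> 'a::ab_group_add \<Rightarrow> 'a) \<Rightarrow> bool" where
  "left_action \<alpha> \<longleftrightarrow>
     (\<forall>s. additive (\<alpha> s)) \<and>
     (\<forall>s t. \<alpha> (s * t) = \<alpha> s \<circ> \<alpha> t) \<and>
     (\<forall>e. (\<forall>s. e * s = s \<and> s * e = s) \<longrightarrow> \<alpha> e = id)"

definition weakly_conjugated ::
  "('s::semigroup_mult \<Rightarrow> 'a::ab_group_add \<Rightarrow> 'a) \<Rightarrow>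
   ('t::semigroup_mult \<Rightarrow> 'b::ab_group_add \<Rightarrow> 'b) \<Rightarrow> bool" where
  "weakly_conjugated \<alpha> \<beta> \<longleftrightarrow> (\<exists>(\<eta> :: 's \<Rightarrow> 't) (\<xi> :: 'a \<Rightarrow> 'b).
     bij \<eta> \<and> (\<forall>s t. \<eta> (s * t) = \<eta> s * \<eta> t) \<and>
     bij \<xi> \<and> additive \<xi> \<and>
     (\<forall>s. \<xi> \<circ> \<alpha> s = \<beta> (\<eta> s) \<circ> \<xi>))"


section \<open>Nets\<close>

definition directed_set :: "'i set \<Rightarrow> ('i \<Rightarrow> 'i \<Rightarrow> bool) \<Rightarrow> bool" where
  "directed_set I le \<longleftrightarrow> I \<noteq> {} \<and>
     (\<forall>i\<in>I. le i i) \<and>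
     (\<forall>i\<in>I. \<forall>j\<in>I. \<forall>k\<in>I. le i j \<longrightarrow> le j k \<longrightarrow> le i k) \<and>
     (\<forall>i\<in>I. \<forall>j\<in>I. \<exists>k\<in>I. le i k \<and> le j k)"

text \<open>The filter generated by the tails of \<^term>\<open>I\<close>, so that
  \<^term>\<open>(f \<longlongrightarrow> L) (net_filter I le)\<close> is convergence of the net \<^term>\<open>f\<close> over \<^term>\<open>I\<close>.\<close>

definition net_filter :: "'i set \<Rightarrow> ('i \<Rightarrow> 'i \<Rightarrow> bool) \<Rightarrow> 'i filter" where
  "net_filter I le = (INF i\<in>I. principal {j\<in>I. le i j})"

lemma eventually_net_filter:
  assumes "directed_set I le"
  shows "eventually P (net_filter I le) \<longleftrightarrow> (\<exists>i\<in>I. \<forall>j\<in>I. le i j \<longrightarrow> P j)"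
proof -
  have "eventually P (net_filter I le) \<longleftrightarrow>
      (\<exists>i\<in>I. eventually P (principal {j\<in>I. le i j}))"
    unfolding net_filter_def
  proof (rule eventually_INF_base)
    show "I \<noteq> {}" using assms by (simp add: directed_set_def)
  next
    fix a b assume ab: "a \<in> I" "b \<in> I"
    then obtain k where "k \<in> I" "le a k" "le b k"
      using assms unfolding directed_set_def by blast
    moreover have tr: "\<And>i j k. i \<in> I \<Longrightarrow> j \<in> I \<Longrightarrow> k \<in> I \<Longrightarrow> le i j \<Longrightarrow> le j k \<Longrightarrow> le i k"
      using assms unfolding directed_set_def by blast
    ultimately have "{j\<in>I. le k j} \<subseteq> {j\<in>I. le a j} \<inter> {j\<in>I. le b j}"
      using ab by blast
    then show "\<exists>x\<in>I. principal {j\<in>I. le x j}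
        \<le> inf (principal {j\<in>I. le a j}) (principal {j\<in>I. le b j})"
      using \<open>k \<in> I\<close> by auto
  qed
  then show ?thesis by (auto simp: eventually_principal)
qed

definition right_folner_net ::
  "'i set \<Rightarrow> ('i \<Rightarrow> 'i \<Rightarrow> bool) \<Rightarrow> ('i \<Rightarrow> 's::semigroup_mult set) \<Rightarrow> bool" where
  "right_folner_net I le F \<longleftrightarrow>
     directed_set I le \<and>
     (\<forall>i\<in>I. finite (F i) \<and> F i \<noteq> {}) \<and>
     (\<forall>s. ((\<lambda>i. real (card ((\<lambda>x. x * s) ` F i - F i)) / real (card (F i))) \<longlongrightarrow> 0)
            (net_filter I le))"


section \<open>Algebraic entropy\<close>

text \<open>The sum is the one of the commutative monoid of subsets of the group
  (\<^theory>\<open>HOL-Library.Set_Algebras\<close>).\<close>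

definition trajectory :: "('s \<Rightarrow> 'a::ab_group_add \<Rightarrow> 'a) \<Rightarrow> 's set \<Rightarrow> 'a set \<Rightarrow> 'a set" where
  "trajectory \<alpha> F X = (\<Sum>s\<in>F. \<alpha> s ` X)"

text \<open>A definition cannot quantify over all index types of nets. Nothing is lost by
  fixing the index type \<^typ>\<open>'s set \<times> 's set set\<close>, since
  every net of subsets has the same limits as one indexed by a set of that type;
  see \<open>folner_net_reindex\<close> and \<open>is_H_alg_any_net\<close> below.\<close>

definition is_H_alg ::
  "('s::semigroup_mult \<Rightarrow> 'a::ab_group_add \<Rightarrow> 'a) \<Rightarrow> 'a set \<Rightarrow> real \<Rightarrow> bool" where
  "is_H_alg \<alpha> X L \<longleftrightarrow>
     (\<forall>(I :: ('s set \<times> 's set set) set) le F. right_folner_net I le F \<longrightarrow>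
        ((\<lambda>i. ln (real (card (trajectory \<alpha> (F i) X))) / real (card (F i))) \<longlongrightarrow> L)
          (net_filter I le))"

definition H_alg ::
  "('s::semigroup_mult \<Rightarrow> 'a::ab_group_add \<Rightarrow> 'a) \<Rightarrow> 'a set \<Rightarrow> real" where
  "H_alg \<alpha> X = (THE L. is_H_alg \<alpha> X L)"

definition h_alg :: "('s::semigroup_mult \<Rightarrow> 'a::ab_group_add \<Rightarrow> 'a) \<Rightarrow> ereal" where
  "h_alg \<alpha> = (SUP X\<in>{X. finite X \<and> X \<noteq> {}}. ereal (H_alg \<alpha> X))"


section \<open>Independence of the index type\<close>

lemma folner_net_reindex:
  fixes F :: "'i \<Rightarrow> 's::semigroup_mult set"
  assumes F: "right_folner_net I le F"
  shows "\<exists>(J :: ('s set \<times> 's set set) set) le'. right_folner_net J le' fst \<and>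
           filtermap fst (net_filter J le') = filtermap F (net_filter I le)"
proof -
  have dir: "directed_set I le" using F by (simp add: right_folner_net_def)
  then have ne: "I \<noteq> {}" and rf: "\<And>i. i \<in> I \<Longrightarrow> le i i"
    and tr: "\<And>i j k. i \<in> I \<Longrightarrow> j \<in> I \<Longrightarrow> k \<in> I \<Longrightarrow> le i j \<Longrightarrow> le j k \<Longrightarrow> le i k"
    and ub: "\<And>i j. i \<in> I \<Longrightarrow> j \<in> I \<Longrightarrow> \<exists>k\<in>I. le i k \<and> le j k"
    unfolding directed_set_def by blast+
  define tl where "tl i = F ` {j\<in>I. le i j}" for i
  define J where "J = {(Y, P). Y \<in> P \<and> (\<exists>i\<in>I. P = tl i)}"
  define le' where "le' = (\<lambda>(p :: 's set \<times> 's set set) (q :: 's set \<times> 's set set). snd q \<subseteq> snd p)"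
  have inJ: "(F i, tl i) \<in> J" if "i \<in> I" for i
    using that rf by (auto simp: J_def tl_def)
  have tl_mono: "tl k \<subseteq> tl i" if "i \<in> I" "k \<in> I" "le i k" for i k
    using that tr unfolding tl_def by blast
  have dir': "directed_set J le'"
    unfolding directed_set_def
  proof (intro conjI ballI impI)
    show "J \<noteq> {}" using ne inJ by blast
  next
    fix p q assume "p \<in> J" "q \<in> J"
    then obtain i j where ij: "i \<in> I" "j \<in> I" "snd p = tl i" "snd q = tl j"
      unfolding J_def by fastforce
    then obtain k where "k \<in> I" "le i k" "le j k" using ub by blast
    then show "\<exists>r\<in>J. le' p r \<and> le' q r"
      using ij inJ[of k] tl_mono by (intro bexI[of _ "(F k, tl k)"]) (auto simp: le'_def)
  qed (auto simp: le'_def)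
  have eq: "filtermap fst (net_filter J le') = filtermap F (net_filter I le)"
    unfolding filter_eq_iff eventually_filtermap
      eventually_net_filter[OF dir] eventually_net_filter[OF dir']
  proof (intro allI iffI)
    fix P assume "\<exists>p\<in>J. \<forall>q\<in>J. le' p q \<longrightarrow> P (fst q)"
    then obtain p where p: "p \<in> J" "\<And>q. q \<in> J \<Longrightarrow> le' p q \<Longrightarrow> P (fst q)" by blast
    then obtain i where i: "i \<in> I" "snd p = tl i" by (auto simp: J_def)
    have "P (F j)" if "j \<in> I" "le i j" for j
      using p(2)[OF inJ[OF that(1)]] tl_mono[OF i(1) that] i(2) by (simp add: le'_def)
    then show "\<exists>i\<in>I. \<forall>j\<in>I. le i j \<longrightarrow> P (F j)" using i(1) by blast
  next
    fix P assume "\<exists>i\<in>I. \<forall>j\<in>I. le i j \<longrightarrow> P (F j)"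
    then obtain i where i: "i \<in> I" "\<And>j. j \<in> I \<Longrightarrow> le i j \<Longrightarrow> P (F j)" by blast
    have "P (fst q)" if "q \<in> J" "le' (F i, tl i) q" for q
    proof -
      have "fst q \<in> tl i" using that by (auto simp: J_def le'_def)
      then show ?thesis using i(2) by (auto simp: tl_def)
    qed
    then show "\<exists>p\<in>J. \<forall>q\<in>J. le' p q \<longrightarrow> P (fst q)" using inJ[OF i(1)] by blast
  qed
  have "((\<lambda>p. real (card ((\<lambda>x. x * s) ` fst p - fst p)) / real (card (fst p))) \<longlongrightarrow> 0)
          (net_filter J le')" for s
  proof -
    let ?g = "\<lambda>Y. real (card ((\<lambda>x. x * s) ` Y - Y)) / real (card Y)"
    have "(?g \<longlongrightarrow> 0) (filtermap F (net_filter I le))"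
      using F unfolding right_folner_net_def filterlim_filtermap by blast
    then have "(?g \<longlongrightarrow> 0) (filtermap fst (net_filter J le'))" by (simp only: eq)
    then show ?thesis by (simp only: filterlim_filtermap)
  qed
  moreover have "\<forall>p\<in>J. finite (fst p) \<and> fst p \<noteq> {}"
    using F by (auto simp: J_def tl_def right_folner_net_def)
  ultimately have "right_folner_net J le' fst"
    using dir' by (simp add: right_folner_net_def)
  with eq show ?thesis by blast
qed

lemma is_H_alg_any_net:
  fixes \<alpha> :: "'s::semigroup_mult \<Rightarrow> 'a::ab_group_add \<Rightarrow> 'a" and F :: "'i \<Rightarrow> 's set"
  assumes L: "is_H_alg \<alpha> X L" and F: "right_folner_net I le F"
  shows "((\<lambda>i. ln (real (card (trajectory \<alpha> (F i) X))) / real (card (F i))) \<longlongrightarrow> L)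
           (net_filter I le)"
proof -
  let ?g = "\<lambda>Y. ln (real (card (trajectory \<alpha> Y X))) / real (card Y)"
  obtain J :: "('s set \<times> 's set set) set" and le' where J: "right_folner_net J le' fst"
    and eq: "filtermap fst (net_filter J le') = filtermap F (net_filter I le)"
    using folner_net_reindex[OF F] by blast
  have "((\<lambda>p. ?g (fst p)) \<longlongrightarrow> L) (net_filter J le')"
    using L J unfolding is_H_alg_def by blast
  then have "(?g \<longlongrightarrow> L) (filtermap fst (net_filter J le'))"
    by (simp only: filterlim_filtermap)
  then show ?thesis by (simp only: eq filterlim_filtermap)
qed

lemma H_alg_eqI:
  fixes \<alpha> :: "'s::semigroup_mult \<Rightarrow> 'a::ab_group_add \<Rightarrow> 'a" and F :: "'i \<Rightarrow> 's set"
  assumes L: "is_H_alg \<alpha> X L" and F: "right_folner_net I le F"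
  shows "H_alg \<alpha> X = L"
  unfolding H_alg_def
proof (rule the_equality[where P = "is_H_alg \<alpha> X"])
  show "is_H_alg \<alpha> X L" by (rule L)
next
  fix L' assume L': "is_H_alg \<alpha> X L'"
  have dir: "directed_set I le" using F by (simp add: right_folner_net_def)
  then have "\<exists>j\<in>I. le i j" if "i \<in> I" for i
    using that unfolding directed_set_def by blast
  then have "\<not> eventually (\<lambda>_. False) (net_filter I le)"
    by (simp add: eventually_net_filter[OF dir])
  then have "net_filter I le \<noteq> bot"
    by (simp add: trivial_limit_def)
  then show "L' = L"
    by (rule tendsto_unique[OF _ is_H_alg_any_net[OF L' F] is_H_alg_any_net[OF L F]])
qed

end

(* A weak conjugation carries the Foelner nets of S to those of T and the trajectory of X along F
   bijectively onto the trajectory of the image of X along the image of F. So X and its image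
   satisfy the same limit condition; hence the entropies agree before taking suprema, whether or
   not the limits exist. *)
theory Submission
  imports Defs
begin

lemma additive_inv:
  fixes f :: "'a::ab_group_add \<Rightarrow> 'b::ab_group_add"
  assumes "bij f" and "additive f"
  shows "additive (inv f)"
proof (rule additive.intro)
  fix x y
  have "f (inv f x + inv f y) = x + y"
    using assms by (simp add: additive.add bij_is_surj surj_f_inv_f)
  then show "inv f (x + y) = inv f x + inv f y"
    by (metis assms(1) bij_is_inj inv_f_f)
qed

lemma additive_image_set_plus:
  fixes f :: "'a::ab_group_add \<Rightarrow> 'b::ab_group_add"
  assumes "additive f"
  shows "f ` (A + B) = f ` A + f ` B"
proof -
  have "f ` (A + B) = (\<lambda>(a, b). f a + f b) ` (A \<times> B)"
    by (auto simp: set_plus_image image_image additive.add[OF assms] split_def)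
  also have "\<dots> = f ` A + f ` B"
    by (auto simp: set_plus_def)
  finally show ?thesis .
qed

lemma additive_image_sum_set:
  fixes f :: "'a::ab_group_add \<Rightarrow> 'b::ab_group_add"
  assumes "additive f"
  shows "f ` (\<Sum>i\<in>I. A i) = (\<Sum>i\<in>I. f ` A i)"
  \<comment> \<open>The sum over an empty index set, and by convention over an infinite one, is
    \<open>{0}\<close>; both cases reduce to an additive map fixing 0.\<close>
  using additive.zero[OF assms]
  by (induction I rule: infinite_finite_induct)
    (auto simp: additive_image_set_plus[OF assms] set_zero)

lemma trajectory_image:
  fixes \<xi> :: "'a::ab_group_add \<Rightarrow> 'b::ab_group_add"
  assumes "inj \<eta>" and "additive \<xi>" and "\<And>s. \<xi> \<circ> \<alpha> s = \<beta> (\<eta> s) \<circ> \<xi>"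
  shows "trajectory \<beta> (\<eta> ` F) (\<xi> ` X) = \<xi> ` trajectory \<alpha> F X"
proof -
  have "trajectory \<beta> (\<eta> ` F) (\<xi> ` X) = (\<Sum>s\<in>F. \<beta> (\<eta> s) ` \<xi> ` X)"
    \<comment> \<open>Injectivity of \<open>\<eta>\<close> is needed to reindex: if two elements of
      \<open>F\<close> had the same image, their two summands would collapse into one.\<close>
    unfolding trajectory_def using assms(1)
    by (subst sum.reindex) (auto intro: inj_on_subset)
  also have "\<dots> = (\<Sum>s\<in>F. \<xi> ` \<alpha> s ` X)"
    by (simp add: image_comp assms(3))
  also have "\<dots> = \<xi> ` trajectory \<alpha> F X"
    by (simp add: trajectory_def additive_image_sum_set[OF assms(2)])
  finally show ?thesis .
qed

text \<open>The index set and its order stay fixed, and the quotients agree index by index: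
  injectivity preserves set differences and cardinalities. Surjectivity enters because the condition
  concerns every \<open>t\<close> of the target, which must be written as
  \<open>\<eta> s\<close>.\<close>

lemma right_folner_net_image:
  fixes \<eta> :: "'s::semigroup_mult \<Rightarrow> 't::semigroup_mult"
  assumes "bij \<eta>" and hom: "\<And>s t. \<eta> (s * t) = \<eta> s * \<eta> t"
    and F: "right_folner_net I le F"
  shows "right_folner_net I le (\<lambda>i. \<eta> ` F i)"
proof -
  have inj: "inj \<eta>" using assms(1) by (rule bij_is_inj)
  have card_image: "card (\<eta> ` A) = card A" for A
    by (rule card_image) (rule inj_on_subset[OF inj subset_UNIV])
  have quotient: "((\<lambda>i. real (card ((\<lambda>x. x * t) ` \<eta> ` F i - \<eta> ` F i)) / real (card (\<eta> ` F i)))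
      \<longlongrightarrow> 0) (net_filter I le)" for t
  proof -
    obtain s where t: "t = \<eta> s" using assms(1) by (meson bij_pointE)
    have "(\<lambda>x. x * t) ` \<eta> ` A - \<eta> ` A = \<eta> ` ((\<lambda>x. x * s) ` A - A)" for A
      by (simp add: t image_set_diff[OF inj] image_image hom)
    then show ?thesis
      using F by (simp add: right_folner_net_def card_image)
  qed
  then show ?thesis
    using F by (simp add: right_folner_net_def)
qed

text \<open>Weak conjugation with its two witnesses kept explicit, so that they can be inverted and
  applied to subsets.\<close>

definition conjugates ::
  "('s::semigroup_mult \<Rightarrow> 't::semigroup_mult) \<Rightarrow> ('a::ab_group_add \<Rightarrow> 'b::ab_group_add) \<Rightarrow>
   ('s \<Rightarrow> 'a \<Rightarrow> 'a) \<Rightarrow> ('t \<Rightarrow> 'b \<Rightarrow> 'b) \<Rightarrow> bool" where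
  "conjugates \<eta> \<xi> \<alpha> \<beta> \<longleftrightarrow>
     bij \<eta> \<and> (\<forall>s t. \<eta> (s * t) = \<eta> s * \<eta> t) \<and>
     bij \<xi> \<and> additive \<xi> \<and>
     (\<forall>s. \<xi> \<circ> \<alpha> s = \<beta> (\<eta> s) \<circ> \<xi>)"

text \<open>This symmetry makes it enough to transport limits in one direction.\<close>

lemma conjugates_inv:
  assumes "conjugates \<eta> \<xi> \<alpha> \<beta>"
  shows "conjugates (inv \<eta>) (inv \<xi>) \<beta> \<alpha>"
proof -
  have \<eta>: "bij \<eta>" "\<And>s t. \<eta> (s * t) = \<eta> s * \<eta> t"
    and \<xi>: "bij \<xi>" "additive \<xi>" "\<And>s. \<xi> \<circ> \<alpha> s = \<beta> (\<eta> s) \<circ> \<xi>"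
    using assms unfolding conjugates_def by blast+
  have "inv \<eta> (s * t) = inv \<eta> s * inv \<eta> t" for s t
    using \<eta> by (metis bij_inv_eq_iff)
  moreover have "inv \<xi> \<circ> \<beta> t = \<alpha> (inv \<eta> t) \<circ> inv \<xi>" for t
  proof
    fix b
    \<comment> \<open>The intertwining identity at \<open>inv \<eta> t\<close> and
      \<open>inv \<xi> b\<close>; applying \<open>inv \<xi>\<close> to both sides gives the
      goal.\<close>
    have "\<xi> (\<alpha> (inv \<eta> t) (inv \<xi> b)) = \<beta> t b"
      using fun_cong[OF \<xi>(3), of "inv \<eta> t" "inv \<xi> b"] \<eta>(1) \<xi>(1)
      by (simp add: bij_is_surj surj_f_inv_f)
    then show "(inv \<xi> \<circ> \<beta> t) b = (\<alpha> (inv \<eta> t) \<circ> inv \<xi>) b"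
      using \<xi>(1) by (metis bij_inv_eq_iff comp_apply)
  qed
  ultimately show ?thesis
    using \<eta>(1) \<xi>(1,2) by (simp add: conjugates_def bij_imp_bij_inv additive_inv)
qed

lemma is_H_alg_conjugates:
  fixes \<alpha> :: "'s::semigroup_mult \<Rightarrow> 'a::ab_group_add \<Rightarrow> 'a"
    and \<beta> :: "'t::semigroup_mult \<Rightarrow> 'b::ab_group_add \<Rightarrow> 'b"
  assumes conj: "conjugates \<eta> \<xi> \<alpha> \<beta>"
    and L: "is_H_alg \<beta> (\<xi> ` X) L"
  shows "is_H_alg \<alpha> X L"
  unfolding is_H_alg_def
proof (intro allI impI)
  fix I :: "('s set \<times> 's set set) set" and le and F :: "'s set \<times> 's set set \<Rightarrow> 's set"
  assume F: "right_folner_net I le F"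
  have \<eta>: "bij \<eta>" "\<And>s t. \<eta> (s * t) = \<eta> s * \<eta> t"
    and \<xi>: "bij \<xi>" "additive \<xi>" "\<And>s. \<xi> \<circ> \<alpha> s = \<beta> (\<eta> s) \<circ> \<xi>"
    using conj unfolding conjugates_def by blast+
  have inj: "inj \<eta>" "inj \<xi>" using \<eta>(1) \<xi>(1) by (simp_all add: bij_is_inj)
  have card_image: "card (\<eta> ` A) = card A" "card (\<xi> ` B) = card B" for A B
    by (rule card_image, meson inj inj_on_subset subset_UNIV)+
  \<comment> \<open>The pushed-forward net lives in the semigroup of \<open>\<beta>\<close> but is
    still indexed by sets over that of \<open>\<alpha>\<close>. This index type is not the one in
    the definition of \<open>is_H_alg \<beta>\<close>, hence the appeal to
    \<open>is_H_alg_any_net\<close>.\<close>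
  have "((\<lambda>i. ln (real (card (trajectory \<beta> (\<eta> ` F i) (\<xi> ` X)))) / real (card (\<eta> ` F i))) \<longlongrightarrow> L)
      (net_filter I le)"
    by (rule is_H_alg_any_net[OF L right_folner_net_image[OF \<eta> F]])
  then show "((\<lambda>i. ln (real (card (trajectory \<alpha> (F i) X))) / real (card (F i))) \<longlongrightarrow> L)
      (net_filter I le)"
    by (simp add: trajectory_image[where \<alpha>=\<alpha> and \<beta>=\<beta>, OF inj(1) \<xi>(2,3)] card_image)
qed

text \<open>Transport along the pair and along its inverse shows that both predicates hold for the
  same \<open>L\<close>. The two definite descriptions then range over one predicate, so no
  existence or uniqueness of the limit has to be proved.\<close>

lemma H_alg_conjugates:
  assumes "conjugates \<eta> \<xi> \<alpha> \<beta>"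
  shows "H_alg \<beta> (\<xi> ` X) = H_alg \<alpha> X"
proof -
  have "inv \<xi> ` \<xi> ` X = X"
    using assms by (simp add: conjugates_def bij_is_inj image_image)
  then have "is_H_alg \<beta> (\<xi> ` X) = is_H_alg \<alpha> X"
    using is_H_alg_conjugates[OF assms, of X]
      is_H_alg_conjugates[OF conjugates_inv[OF assms], of "\<xi> ` X"] by auto
  then show ?thesis
    by (simp add: H_alg_def)
qed

theorem proposition4p11:
  fixes \<alpha> :: "'s::semigroup_mult \<Rightarrow> 'a::ab_group_add \<Rightarrow> 'a"
    and \<beta> :: "'t::semigroup_mult \<Rightarrow> 'b::ab_group_add \<Rightarrow> 'b"
  assumes "cancellative TYPE('s)" and "right_amenable TYPE('s)"
    and "cancellative TYPE('t)" and "right_amenable TYPE('t)"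
    and "left_action \<alpha>" and "left_action \<beta>"
    and "weakly_conjugated \<alpha> \<beta>"
  shows "h_alg \<alpha> = h_alg \<beta>"
proof -
  obtain \<eta> \<xi> where conj: "conjugates \<eta> \<xi> \<alpha> \<beta>"
    using \<open>weakly_conjugated \<alpha> \<beta>\<close> unfolding weakly_conjugated_def conjugates_def by blast
  then have \<xi>: "bij \<xi>"
    by (simp add: conjugates_def)
  have "Y \<in> image \<xi> ` {X. finite X \<and> X \<noteq> {}}" if "finite Y" "Y \<noteq> {}" for Y
  proof
    show "Y = \<xi> ` inv \<xi> ` Y"
      using \<xi> by (simp add: bij_is_surj image_f_inv_f)
  qed (use that in simp)
  then have "{Y. finite Y \<and> Y \<noteq> {}} = image \<xi> ` {X. finite X \<and> X \<noteq> {}}"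
    by blast
  then show ?thesis
    by (simp add: h_alg_def image_image H_alg_conjugates[OF conj])
qed

end
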